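(* Let $\{P_\theta\}_{\theta\in\Theta}$ be a family of probability measures on a measurable space $(\Omega,\mathcal{F})$, where $\Theta$ is partitioned into $\Theta_0$ (null) and $\Theta_1$ (alternative). Let $E$ be an e-variable for $\Theta_0$ and $S$ a sufficient statistic for $\Theta$. Set $G=\mathbb{E}_\Theta[E\mid S]$. Then for all $\theta\in\Theta$, $\mathbb{E}_\theta[E/G]\le 1$, and therefore $\mathbb{E}_\theta[\log(E/G)]\le 0$.
   Context: Random variables are measurable functions on $\Omega$ with values in $[-\infty,\infty]$; $\mathbb{E}_\theta$ denotes expectation under $P_\theta$. The expectation $\mathbb{E}[Y]$ is well-defined as an element of $[-\infty,\infty]$ if $\mathbb{E}[Y^+]$ or $\mathbb{E}[Y^-]$ is finite; generalized conditional expectations then exist (in particular for all $Y\ge 0$). An e-variable for $\Theta_0$ is a $[0,\infty]$-valued random variable $E$ with $\mathbb{E}_\theta[E]\le 1$ for all $\theta\in\Theta_0$. A measurable function $S$ on $\Omega$ (with values in a measurable space) is a sufficient statistic for $\Theta$ if for every random variable $h$ on $\Omega$ there is a measurable function $g_h$ such that $\mathbb{E}_\theta[h\mid S]=g_h(S)$ $P_\theta$-a.s. for all $\theta\in\Theta$, whenever these conditional expectations exist (in particular whenever $h\ge 0$). Conditioning on $S$ means conditioning on $\sigma(S)$. The common version $g_h(S)$ is denoted $\mathbb{E}_\Theta[h\mid S]$. Ratios use the conventions $0/0=0$ and $\infty/\infty=1$; also $\log 0=-\infty$, $\log\infty=\infty$. *)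

theory Defs
  imports "HOL-Probability.Probability"
begin

(* Since e2ennreal x = max 0 x, the two integrals below are E[Y^+] and E[Y^-].  A random variable
   is a Borel measurable function with values in ereal = [-\<infinity>, \<infinity>]; measurability is
   part of "well-defined", because nn_integral is total on non-measurable functions too. *)

definition has_expectation :: "'a measure \<Rightarrow> ('a \<Rightarrow> ereal) \<Rightarrow> bool" where
  "has_expectation M Y \<longleftrightarrow> Y \<in> borel_measurable M \<and>
     ((\<integral>\<^sup>+ \<omega>. e2ennreal (Y \<omega>) \<partial>M) < \<infinity> \<or>
      (\<integral>\<^sup>+ \<omega>. e2ennreal (- Y \<omega>) \<partial>M) < \<infinity>)"

(* Only meaningful under has_expectation; in ereal, \<infinity> - \<infinity> = \<infinity>. *)
definition ext_expectation :: "'a measure \<Rightarrow> ('a \<Rightarrow> ereal) \<Rightarrow> ereal" where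
  "ext_expectation M Y =
     enn2ereal (\<integral>\<^sup>+ \<omega>. e2ennreal (Y \<omega>) \<partial>M) - enn2ereal (\<integral>\<^sup>+ \<omega>. e2ennreal (- Y \<omega>) \<partial>M)"

(* E[Y^+ | F] - E[Y^- | F].  If has_expectation M Y, then one of the two terms is finite
   almost surely, so the difference is unambiguous almost surely. *)
definition ext_cond_exp :: "'a measure \<Rightarrow> 'a measure \<Rightarrow> ('a \<Rightarrow> ereal) \<Rightarrow> 'a \<Rightarrow> ereal" where
  "ext_cond_exp M F Y \<omega> =
     enn2ereal (nn_cond_exp M F (\<lambda>x. e2ennreal (Y x)) \<omega>)
     - enn2ereal (nn_cond_exp M F (\<lambda>x. e2ennreal (- Y x)) \<omega>)"

definition sigma_gen :: "'a measure \<Rightarrow> 'b measure \<Rightarrow> ('a \<Rightarrow> 'b) \<Rightarrow> 'a measure" where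
  "sigma_gen M N S = vimage_algebra (space M) S N"

(* In the following, P is the family of measures, M carries the measurable space
   (\<Omega>, F) (its own measure is irrelevant), and S takes values in the measurable space N. *)

definition common_cond_exp ::
  "('i \<Rightarrow> 'a measure) \<Rightarrow> 'i set \<Rightarrow> 'a measure \<Rightarrow> 'b measure \<Rightarrow> ('a \<Rightarrow> 'b) \<Rightarrow>
   ('a \<Rightarrow> ereal) \<Rightarrow> ('b \<Rightarrow> ereal) \<Rightarrow> bool" where
  "common_cond_exp P \<Theta> M N S h g \<longleftrightarrow> g \<in> borel_measurable N \<and>
     (\<forall>\<theta>\<in>\<Theta>. has_expectation (P \<theta>) h \<longrightarrow>
        (AE \<omega> in P \<theta>. ext_cond_exp (P \<theta>) (sigma_gen M N S) h \<omega> = g (S \<omega>)))"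

definition sufficient_statistic ::
  "('i \<Rightarrow> 'a measure) \<Rightarrow> 'i set \<Rightarrow> 'a measure \<Rightarrow> 'b measure \<Rightarrow> ('a \<Rightarrow> 'b) \<Rightarrow> bool" where
  "sufficient_statistic P \<Theta> M N S \<longleftrightarrow> S \<in> measurable M N \<and>
     (\<forall>h \<in> borel_measurable M. \<exists>g. common_cond_exp P \<Theta> M N S h g)"

definition e_variable ::
  "('i \<Rightarrow> 'a measure) \<Rightarrow> 'i set \<Rightarrow> 'a measure \<Rightarrow> ('a \<Rightarrow> ereal) \<Rightarrow> bool" where
  "e_variable P \<Theta>\<^sub>0 M E \<longleftrightarrow> E \<in> borel_measurable M \<and> (\<forall>\<omega>\<in>space M. 0 \<le> E \<omega>) \<and>
     (\<forall>\<theta>\<in>\<Theta>\<^sub>0. ext_expectation (P \<theta>) E \<le> 1)"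

(* ereal division gives 0 / 0 = 0 and x / 0 = \<infinity> for x > 0, but \<infinity> / \<infinity> = 0. *)
definition ratio :: "ereal \<Rightarrow> ereal \<Rightarrow> ereal" where
  "ratio a b = (if a = \<infinity> \<and> b = \<infinity> then 1 else a / b)"

(* The value at negative arguments is a dummy. *)
definition ext_ln :: "ereal \<Rightarrow> ereal" where
  "ext_ln x = (if x = \<infinity> then \<infinity> else if x \<le> 0 then - \<infinity> else ereal (ln (real_of_ereal x)))"

end

theory Submission
  imports Defs
begin

text \<open>
  Writing \<open>c\<close> for the conditional expectation of \<open>E\<close>, the ratio is at most
  \<open>E * inverse c\<close> plus the indicator of \<open>c = \<infinity>\<close>. Since \<open>inverse c\<close> is \<open>\<sigma>(S)\<close>-measurable,
  averaging replaces \<open>E\<close> by \<open>c\<close>, and \<open>c * inverse c\<close> is the indicator of \<open>0 < c < \<infinity>\<close>.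
  The logarithmic bound then follows from \<open>ln x \<le> x - 1\<close>.
\<close>

lemma e2ennreal_eq_0: "x \<le> 0 \<Longrightarrow> e2ennreal x = 0"
  by (simp add: e2ennreal_neg)

text \<open>In \<open>ennreal\<close> the product already respects 0/0 = 0, since
  \<open>\<top>\<close> times 0 is 0, but it vanishes at \<open>b = \<infinity>\<close>. The
  indicator repairs this for the convention that infinity over infinity is 1; for finite
  \<open>a\<close> it only overshoots, hence an inequality.\<close>

lemma e2ennreal_ratio_le:
  assumes "0 \<le> a" "0 \<le> b"
  shows "e2ennreal (ratio a b) \<le>
    inverse (e2ennreal b) * e2ennreal a + (if e2ennreal b = \<top> then 1 else 0)"
proof -
  have *: "e2ennreal (enn2ereal x / enn2ereal y) = inverse y * x" for x y
    by (simp add: divide_ereal_def mult.commute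
        flip: inverse_ennreal.rep_eq times_ennreal.rep_eq)
  obtain x y where "a = enn2ereal x" "b = enn2ereal y"
    using assms enn2ereal_e2ennreal by metis
  then show ?thesis
    by (auto simp: ratio_def * e2ennreal_enn2ereal simp flip: one_ennreal_def)
qed

lemma ratio_nonneg: "0 \<le> a \<Longrightarrow> 0 \<le> b \<Longrightarrow> 0 \<le> ratio a b"
  by (simp add: ratio_def)

lemma borel_measurable_ratio [measurable]:
  assumes [measurable]: "f \<in> borel_measurable M" "h \<in> borel_measurable M"
  shows "(\<lambda>x. ratio (f x) (h x)) \<in> borel_measurable M"
  unfolding ratio_def by measurable

lemma borel_measurable_ext_ln [measurable]: "ext_ln \<in> borel_measurable borel"
  unfolding ext_ln_def[abs_def] by measurable

text \<open>The inequality \<open>ln x \<le> x - 1\<close>, with the parts arranged so that no subtraction occurs.\<close>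

lemma e2ennreal_ext_ln_le:
  "e2ennreal (ext_ln x) + 1 \<le> e2ennreal x + e2ennreal (- ext_ln x)"
proof (cases x)
  case (real r)
  show ?thesis
  \<comment> \<open>For r at most 0, the logarithm is minus infinity and makes the right-hand side
    \<open>\<top>\<close>.\<close>
  proof (cases "r \<le> 0")
    case True
    then show ?thesis using real by (simp add: ext_ln_def)
  next
    case False
    have "ennreal (ln r) + 1 \<le> ennreal r + ennreal (- ln r)"
    proof (cases "0 \<le> ln r")
      case True
      then have "ennreal (ln r) + 1 = ennreal (ln r + 1)"
        by simp
      also have "\<dots> \<le> ennreal r"
        using ln_le_minus_one[of r] False by (intro ennreal_leI) auto
      finally show ?thesis
        using True by (simp add: ennreal_neg)
    next
      case neg: False
      then have "ennreal r + ennreal (- ln r) = ennreal (r - ln r)"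
        using False by (simp flip: ennreal_plus)
      moreover have "1 \<le> ennreal (r - ln r)"
        using ln_le_minus_one[of r] False by (simp add: ennreal_1[symmetric] del: ennreal_1)
      ultimately show ?thesis
        using neg by (simp add: ennreal_neg)
    qed
    then show ?thesis
      using real False by (simp add: ext_ln_def)
  qed
qed (auto simp: ext_ln_def)

text \<open>Nonnegativity is asked only almost everywhere because the lemma is applied to the ratio:
  its denominator \<open>G\<close> is a version of a conditional expectation and may be negative on
  a null set.\<close>

lemma ext_expectation_nonneg:
  assumes "Y \<in> borel_measurable M" "AE x in M. 0 \<le> Y x"
  shows "has_expectation M Y"
    and "ext_expectation M Y = enn2ereal (\<integral>\<^sup>+ x. e2ennreal (Y x) \<partial>M)"
proof -
  have "(\<integral>\<^sup>+ x. e2ennreal (- Y x) \<partial>M) = (\<integral>\<^sup>+ x. 0 \<partial>M)"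
    using assms(2) by (intro nn_integral_cong_AE) (auto simp: e2ennreal_eq_0)
  then show "has_expectation M Y"
    "ext_expectation M Y = enn2ereal (\<integral>\<^sup>+ x. e2ennreal (Y x) \<partial>M)"
    using assms(1) by (simp_all add: has_expectation_def ext_expectation_def zero_ennreal.rep_eq)
qed

text \<open>Integrating the pointwise logarithm bound over a space of mass 1 gives
  \<open>?p + 1 \<le> 1 + ?n\<close>. The finite 1 cancels even if \<open>?n\<close> is
  infinite.\<close>

lemma (in prob_space) ext_expectation_ext_ln:
  assumes [measurable]: "Y \<in> borel_measurable M"
    and le: "(\<integral>\<^sup>+ x. e2ennreal (Y x) \<partial>M) \<le> 1"
  shows "has_expectation M (\<lambda>x. ext_ln (Y x))"
    and "ext_expectation M (\<lambda>x. ext_ln (Y x)) \<le> 0"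
proof -
  let ?p = "\<integral>\<^sup>+ x. e2ennreal (ext_ln (Y x)) \<partial>M"
  let ?n = "\<integral>\<^sup>+ x. e2ennreal (- ext_ln (Y x)) \<partial>M"
  have "?p + 1 = (\<integral>\<^sup>+ x. e2ennreal (ext_ln (Y x)) + 1 \<partial>M)"
    by (subst nn_integral_add) (auto simp: emeasure_space_1)
  also have "\<dots> \<le> (\<integral>\<^sup>+ x. e2ennreal (Y x) + e2ennreal (- ext_ln (Y x)) \<partial>M)"
    by (intro nn_integral_mono e2ennreal_ext_ln_le)
  also have "\<dots> = (\<integral>\<^sup>+ x. e2ennreal (Y x) \<partial>M) + ?n"
    by (intro nn_integral_add) auto
  also have "\<dots> \<le> 1 + ?n"
    using le by (intro add_right_mono)
  finally have pn: "?p \<le> ?n"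
    by (simp add: add.commute ennreal_add_left_cancel_le)
  \<comment> \<open>Where the logarithm is nonnegative its negative part is 0, so the pointwise
    bound leaves ln x + 1 at most x.\<close>
  have "e2ennreal (ext_ln x) \<le> e2ennreal x" for x
  proof (cases "0 \<le> ext_ln x")
    case True
    then show ?thesis
      using e2ennreal_ext_ln_le[of x] order_trans[OF add_increasing2[OF zero_le_one order_refl]]
      by (simp add: e2ennreal_eq_0)
  qed (simp add: e2ennreal_eq_0)
  then have "?p \<le> (\<integral>\<^sup>+ x. e2ennreal (Y x) \<partial>M)"
    by (intro nn_integral_mono)
  then have p: "?p < \<infinity>"
    using le by (metis ennreal_one_less_top infinity_ennreal_def order_le_less_trans)
  then show "has_expectation M (\<lambda>x. ext_ln (Y x))"
    by (simp add: has_expectation_def)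
  \<comment> \<open>\<open>pn\<close> alone would not suffice: infinity minus infinity is infinity
    in \<open>ereal\<close>, and the finiteness \<open>p\<close> excludes that case.\<close>
  show "ext_expectation M (\<lambda>x. ext_ln (Y x)) \<le> 0"
    unfolding ext_expectation_def using pn p
    by (intro ereal_diff_nonpos) (auto simp: less_eq_ennreal.rep_eq)
qed

text \<open>The negative part of \<open>Y\<close> is almost surely 0, and the constant 0, being
  measurable for \<open>F\<close>, is its own conditional expectation.\<close>

lemma ext_cond_exp_nonneg:
  assumes "sigma_finite_subalgebra M F" "Y \<in> borel_measurable M" "AE x in M. 0 \<le> Y x"
  shows "AE x in M. ext_cond_exp M F Y x = enn2ereal (nn_cond_exp M F (\<lambda>x. e2ennreal (Y x)) x)"
proof -
  interpret sigma_finite_subalgebra M F by fact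
  note [measurable] = assms(2)
  have "AE x in M. nn_cond_exp M F (\<lambda>x. e2ennreal (- Y x)) x = nn_cond_exp M F (\<lambda>x. 0) x"
    using assms(3) by (intro nn_cond_exp_cong) (auto simp: e2ennreal_eq_0)
  moreover have "AE x in M. (0::ennreal) = nn_cond_exp M F (\<lambda>x. 0) x"
    by (intro nn_cond_exp_F_meas) auto
  ultimately show ?thesis
    by eventually_elim (simp add: ext_cond_exp_def zero_ennreal.rep_eq)
qed

theorem theorem2p8:
  fixes P :: "'i \<Rightarrow> 'a measure"
    and \<Theta> \<Theta>\<^sub>0 \<Theta>\<^sub>1 :: "'i set"
    and M :: "'a measure" and N :: "'b measure"
    and S :: "'a \<Rightarrow> 'b"
    and E G :: "'a \<Rightarrow> ereal"
    and g :: "'b \<Rightarrow> ereal"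
  assumes "\<And>\<theta>. \<theta> \<in> \<Theta> \<Longrightarrow> prob_space (P \<theta>)"
    and "\<And>\<theta>. \<theta> \<in> \<Theta> \<Longrightarrow> sets (P \<theta>) = sets M"
    and "\<Theta> = \<Theta>\<^sub>0 \<union> \<Theta>\<^sub>1" and "\<Theta>\<^sub>0 \<inter> \<Theta>\<^sub>1 = {}"
    and "e_variable P \<Theta>\<^sub>0 M E"
    and "sufficient_statistic P \<Theta> M N S"
    and "common_cond_exp P \<Theta> M N S E g"
    and "G = (\<lambda>\<omega>. g (S \<omega>))"
  shows "\<forall>\<theta>\<in>\<Theta>.
      (has_expectation (P \<theta>) (\<lambda>\<omega>. ratio (E \<omega>) (G \<omega>)) \<and>
       ext_expectation (P \<theta>) (\<lambda>\<omega>. ratio (E \<omega>) (G \<omega>)) \<le> 1) \<and>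
      (has_expectation (P \<theta>) (\<lambda>\<omega>. ext_ln (ratio (E \<omega>) (G \<omega>))) \<and>
       ext_expectation (P \<theta>) (\<lambda>\<omega>. ext_ln (ratio (E \<omega>) (G \<omega>))) \<le> 0)"
proof
  fix \<theta> assume \<theta>: "\<theta> \<in> \<Theta>"
  define Q F where "Q = P \<theta>" and "F = sigma_gen M N S"
  interpret prob_space Q
    using assms(1)[OF \<theta>] by (simp add: Q_def)
  have sets_Q [measurable_cong]: "sets Q = sets M"
    using assms(2)[OF \<theta>] by (simp add: Q_def)
  then have space_Q: "space Q = space M"
    by (rule sets_eq_imp_space_eq)
  have S_M: "S \<in> measurable M N" and g [measurable]: "g \<in> borel_measurable N"
    using assms(6,7) by (auto simp: sufficient_statistic_def common_cond_exp_def)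
  have E_M: "E \<in> borel_measurable M" and E_nonneg: "\<And>\<omega>. \<omega> \<in> space Q \<Longrightarrow> 0 \<le> E \<omega>"
    using assms(5) by (auto simp: e_variable_def space_Q)
  have [measurable]: "E \<in> borel_measurable Q" "S \<in> measurable Q N"
    using E_M S_M by (simp_all add: measurable_cong_sets[OF sets_Q refl])
  have S_F: "S \<in> measurable F N"
    unfolding F_def sigma_gen_def
    by (intro measurable_vimage_algebra1) (use measurable_space[OF S_M] in auto)
  \<comment> \<open>\<open>G\<close> factors through \<open>S\<close>, so it is measurable for
    \<open>F\<close> itself, not merely almost surely equal to such a function. This is what allows
    \<open>inverse (c \<omega>)\<close> to be used as a factor in the averaging identity.\<close>
  have G_F: "G \<in> borel_measurable F"
    unfolding assms(8) by (rule measurable_compose[OF S_F g])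
  have [measurable]: "G \<in> borel_measurable Q"
    unfolding assms(8) by measurable
  have "sets F \<subseteq> sets M"
    unfolding F_def sigma_gen_def
    by (intro sets_image_in_sets[OF refl S_M])
  then have "subalgebra Q F"
    by (simp add: subalgebra_def sets_Q space_Q F_def sigma_gen_def)
  then interpret finite_measure_subalgebra Q F
    by unfold_locales

  define e c where "e \<omega> = e2ennreal (E \<omega>)" and "c \<omega> = e2ennreal (G \<omega>)" for \<omega>
  have [measurable]: "e \<in> borel_measurable Q" "c \<in> borel_measurable Q"
    unfolding e_def[abs_def] c_def[abs_def] by measurable
  have inv_c: "(\<lambda>\<omega>. inverse (c \<omega>)) \<in> borel_measurable F"
    unfolding c_def using G_F by measurable
  have "has_expectation Q E"
    using E_nonneg by (intro ext_expectation_nonneg) auto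
  then have "AE \<omega> in Q. ext_cond_exp Q F E \<omega> = G \<omega>"
    using assms(7,8) \<theta> unfolding common_cond_exp_def Q_def F_def by blast
  moreover have "AE \<omega> in Q. ext_cond_exp Q F E \<omega> = enn2ereal (nn_cond_exp Q F e \<omega>)"
    unfolding e_def using E_nonneg
    by (intro ext_cond_exp_nonneg) (auto intro: sigma_finite_subalgebra_axioms)
  ultimately have G_eq: "AE \<omega> in Q. G \<omega> = enn2ereal (nn_cond_exp Q F e \<omega>)"
    by eventually_elim simp

  let ?R = "\<lambda>\<omega>. ratio (E \<omega>) (G \<omega>)"
  let ?top = "\<lambda>\<omega>. if c \<omega> = \<top> then 1 else 0 :: ennreal"
  have G_nonneg: "AE \<omega> in Q. 0 \<le> G \<omega>"
    using G_eq by eventually_elim simp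
  then have R_nonneg: "AE \<omega> in Q. 0 \<le> ?R \<omega>"
    using E_nonneg by (auto intro: ratio_nonneg)
  have "(\<integral>\<^sup>+ \<omega>. e2ennreal (?R \<omega>) \<partial>Q) \<le> (\<integral>\<^sup>+ \<omega>. inverse (c \<omega>) * e \<omega> + ?top \<omega> \<partial>Q)"
  proof (rule nn_integral_mono_AE)
    show "AE \<omega> in Q. e2ennreal (?R \<omega>) \<le> inverse (c \<omega>) * e \<omega> + ?top \<omega>"
      using G_nonneg AE_space unfolding c_def e_def
      by eventually_elim (intro e2ennreal_ratio_le E_nonneg)
  qed
  also have "\<dots> = (\<integral>\<^sup>+ \<omega>. inverse (c \<omega>) * e \<omega> \<partial>Q) + (\<integral>\<^sup>+ \<omega>. ?top \<omega> \<partial>Q)"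
    by (intro nn_integral_add) auto
  \<comment> \<open>The defining property of the conditional expectation holds for nonnegative
    factors without integrability, so infinite values of \<open>inverse (c \<omega>)\<close> do no
    harm.\<close>
  also have "(\<integral>\<^sup>+ \<omega>. inverse (c \<omega>) * e \<omega> \<partial>Q) = (\<integral>\<^sup>+ \<omega>. inverse (c \<omega>) * nn_cond_exp Q F e \<omega> \<partial>Q)"
    by (rule nn_cond_exp_intg[symmetric]) (auto intro: inv_c)
  also have "\<dots> = (\<integral>\<^sup>+ \<omega>. inverse (c \<omega>) * c \<omega> \<partial>Q)"
    using G_eq by (intro nn_integral_cong_AE) (auto simp: c_def)
  also have "\<dots> + (\<integral>\<^sup>+ \<omega>. ?top \<omega> \<partial>Q) = (\<integral>\<^sup>+ \<omega>. inverse (c \<omega>) * c \<omega> + ?top \<omega> \<partial>Q)"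
    by (intro nn_integral_add[symmetric]) auto
  also have "\<dots> \<le> (\<integral>\<^sup>+ \<omega>. 1 \<partial>Q)"
  proof (rule nn_integral_mono)
    fix \<omega>
    show "inverse (c \<omega>) * c \<omega> + ?top \<omega> \<le> 1"
    \<comment> \<open>At 0 and at \<open>\<top>\<close> the product is 0 times
      \<open>\<top>\<close>, which is 0. Only at \<open>\<top>\<close> does the indicator
      contribute, so the sum never exceeds 1.\<close>
    proof (cases "c \<omega> = 0 \<or> c \<omega> = \<top>")
      case False
      then have "inverse (c \<omega>) * c \<omega> = 1"
        using ennreal_divide_self[of "c \<omega>"]
        by (simp add: divide_ennreal_def mult.commute less_top)
      then show ?thesis using False by simp
    qed auto
  qed
  also have "\<dots> = 1"
    by (simp add: emeasure_space_1)
  finally have le: "(\<integral>\<^sup>+ \<omega>. e2ennreal (?R \<omega>) \<partial>Q) \<le> 1" .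
  have "has_expectation Q ?R" "ext_expectation Q ?R \<le> 1"
    using ext_expectation_nonneg[OF _ R_nonneg] le
    by (simp_all add: less_eq_ennreal.rep_eq one_ennreal.rep_eq)
  moreover have "has_expectation Q (\<lambda>\<omega>. ext_ln (?R \<omega>))" "ext_expectation Q (\<lambda>\<omega>. ext_ln (?R \<omega>)) \<le> 0"
    using ext_expectation_ext_ln[OF _ le] by simp_all
  ultimately show "(has_expectation (P \<theta>) ?R \<and> ext_expectation (P \<theta>) ?R \<le> 1) \<and>
      (has_expectation (P \<theta>) (\<lambda>\<omega>. ext_ln (?R \<omega>)) \<and>
       ext_expectation (P \<theta>) (\<lambda>\<omega>. ext_ln (?R \<omega>)) \<le> 0)"
    by (simp add: Q_def)
qed

end
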